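(* Let $t\geq 4$ be an integer and let $\Gamma$ be a finite group. Then $rc(CG(\Gamma))=t$ if and only if $\Gamma$ is nonabelian, has trivial center, and has exactly $t$ maximal abelian subgroups of order $2$.
   Context: For a finite group $\Gamma$, the commuting graph $CG(\Gamma)$ is the simple graph with vertex set $\Gamma$ in which two distinct elements $a,b$ are adjacent if and only if $ab=ba$. For a connected graph $G$, an edge coloring (adjacent edges may share colors) makes $G$ rainbow-connected if every two distinct vertices are joined by a path whose edges all have pairwise distinct colors; the rainbow connection number $rc(G)$ is the minimum number of colors in such a coloring. The center $Z(\Gamma)=\{z\in\Gamma: za=az \text{ for all } a\in\Gamma\}$ is trivial if it equals $\{e\}$. A maximal abelian subgroup of $\Gamma$ is an abelian subgroup not properly contained in any other abelian subgroup of $\Gamma$. *)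

theory Defs
  imports "HOL-Algebra.Coset" "Graph_Theory.Graph_Theory"
begin

text \<open>
  Simple undirected graphs are symmetric loop-free digraphs (locale \<^locale>\<open>pair_graph\<close>):
  an edge between \<open>u\<close> and \<open>v\<close> is the pair of arcs \<open>(u, v)\<close> and \<open>(v, u)\<close>. An edge colouring
  therefore has to give both arcs the same colour. It need not be proper.
\<close>

definition edge_coloring :: "'a pair_pre_digraph \<Rightarrow> nat \<Rightarrow> ('a \<times> 'a \<Rightarrow> nat) \<Rightarrow> bool" where
  "edge_coloring D k c \<longleftrightarrow>
     c ` parcs D \<subseteq> {..<k} \<and> (\<forall>(u, v) \<in> parcs D. c (u, v) = c (v, u))"

definition rainbow_connected :: "'a pair_pre_digraph \<Rightarrow> ('a \<times> 'a \<Rightarrow> nat) \<Rightarrow> bool" where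
  "rainbow_connected D c \<longleftrightarrow>
     (\<forall>u \<in> pverts D. \<forall>v \<in> pverts D. u \<noteq> v \<longrightarrow>
        (\<exists>p. pre_digraph.apath (with_proj D) u p v \<and> distinct (map c p)))"

text \<open>
  Meaningful for finite connected graphs only: otherwise the set of admissible \<open>k\<close> may be
  empty and the value unspecified.
\<close>

definition rainbow_connection_number :: "'a pair_pre_digraph \<Rightarrow> nat" where
  "rainbow_connection_number D = (LEAST k. \<exists>c. edge_coloring D k c \<and> rainbow_connected D c)"

definition commuting_graph :: "('a, 'b) monoid_scheme \<Rightarrow> 'a pair_pre_digraph" where
  "commuting_graph G =
     \<lparr>pverts = carrier G,
      parcs = {(a, b). a \<in> carrier G \<and> b \<in> carrier G \<and> a \<noteq> b \<and> a \<otimes>\<^bsub>G\<^esub> b = b \<otimes>\<^bsub>G\<^esub> a}\<rparr>"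

definition group_center :: "('a, 'b) monoid_scheme \<Rightarrow> 'a set" where
  "group_center G = {z \<in> carrier G. \<forall>a \<in> carrier G. z \<otimes>\<^bsub>G\<^esub> a = a \<otimes>\<^bsub>G\<^esub> z}"

definition abelian_subgroup :: "'a set \<Rightarrow> ('a, 'b) monoid_scheme \<Rightarrow> bool" where
  "abelian_subgroup H G \<longleftrightarrow> subgroup H G \<and> comm_group (G\<lparr>carrier := H\<rparr>)"

definition maximal_abelian_subgroup :: "'a set \<Rightarrow> ('a, 'b) monoid_scheme \<Rightarrow> bool" where
  "maximal_abelian_subgroup H G \<longleftrightarrow>
     abelian_subgroup H G \<and> \<not> (\<exists>K. abelian_subgroup K G \<and> H \<subset> K)"

lemma pair_graph_commuting_graph:
  assumes "finite (carrier G)"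
  shows "pair_graph (commuting_graph G)"
proof
  show "finite (parcs (commuting_graph G))"
    by (rule finite_subset[of _ "carrier G \<times> carrier G"])
      (auto simp: commuting_graph_def assms)
qed (auto simp: commuting_graph_def assms symmetric_def sym_def arcs_ends_def arc_to_ends_def)

lemma connected_commuting_graph:
  assumes "group G" "finite (carrier G)"
  shows "connected (with_proj (commuting_graph G))"
proof -
  interpret group G by fact
  interpret C: pair_graph "commuting_graph G"
    by (rule pair_graph_commuting_graph) fact
  have arc: "a \<rightarrow>\<^sup>*\<^bsub>with_proj (commuting_graph G)\<^esub> b"
    if "a \<in> carrier G" "b \<in> carrier G" "a = \<one>\<^bsub>G\<^esub> \<or> b = \<one>\<^bsub>G\<^esub>" for a b
  proof (cases "a = b")
    case True
    with that have "a \<in> pverts (commuting_graph G)" by (simp add: commuting_graph_def)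
    with True show ?thesis by simp
  next
    case False
    with that have "(a, b) \<in> parcs (commuting_graph G)"
      by (auto simp: commuting_graph_def)
    then show ?thesis by (intro C.reachable_adjI) simp
  qed
  have "a \<rightarrow>\<^sup>*\<^bsub>with_proj (commuting_graph G)\<^esub> b" if "a \<in> carrier G" "b \<in> carrier G" for a b
    using arc[of a "\<one>\<^bsub>G\<^esub>"] arc[of "\<one>\<^bsub>G\<^esub>" b] that C.reachable_trans by blast
  then show ?thesis
    unfolding connected_def
    by (intro strongly_connectedI C.reachable_mk_symmetricI) (auto simp: commuting_graph_def)
qed

end

theory Submission
  imports Defs
begin

text \<open>
  The identity is adjacent to every other vertex of the commuting graph. Two leaves hanging on
  such a dominating vertex \<open>r\<close> are joined by a single path, so the edges from \<open>r\<close> to leaves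
  need distinct colours. Conversely, the vertices other than \<open>r\<close> that are not leaves induce a
  graph without isolated vertices. A maximal independent set \<open>A\<close> of it gives a partition in which
  every vertex has a neighbour on the other side. Give the edges from \<open>r\<close> to the two sides the
  colours \<open>0\<close> and \<open>1\<close>, the edges avoiding \<open>r\<close> the colour \<open>2\<close>, and the edges from \<open>r\<close> to leaves
  pairwise distinct colours: if the edges from \<open>r\<close> to \<open>u\<close> and \<open>v\<close> share a colour, then a detour
  through the other side joins \<open>u\<close> and \<open>v\<close>. So the rainbow connection number lies
  between the number \<open>s\<close> of leaves and \<open>max 3 s\<close>. In the commuting graph, the leaf \<open>x\<close>
  corresponds to the maximal abelian subgroup \<open>{1, x}\<close>.
\<close>

section \<open>Graphs with a dominating vertex\<close>

definition leaves_at :: "'a pair_pre_digraph \<Rightarrow> 'a \<Rightarrow> 'a set" where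
  "leaves_at D r = {v \<in> pverts D. v \<noteq> r \<and> (\<forall>w. (v, w) \<in> parcs D \<longrightarrow> w = r)}"

locale dominated_graph = pair_graph D for D :: "'a pair_pre_digraph" +
  fixes r :: 'a
  assumes root: "r \<in> pverts D"
    and dominating: "\<And>v. v \<in> pverts D \<Longrightarrow> v \<noteq> r \<Longrightarrow> (r, v) \<in> parcs D"
begin

lemma arc_sym: "(u, v) \<in> parcs D \<Longrightarrow> (v, u) \<in> parcs D"
  using sym_arcs by (auto simp: symmetric_def sym_def arcs_ends_def arc_to_ends_def)

lemma arc_verts: "(u, v) \<in> parcs D \<Longrightarrow> u \<in> pverts D \<and> v \<in> pverts D"
  using in_arcsD1 in_arcsD2 by auto

lemma finite_leaves: "finite (leaves_at D r)"
  using finite_verts by (auto simp: leaves_at_def)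

lemma apath_arc:
  "(u, v) \<in> parcs D \<Longrightarrow> u \<noteq> v \<Longrightarrow> apath u [(u, v)] v"
  by (auto simp: apath_def awalk_def dest: arc_verts)

lemma apath_two_arcs:
  "(u, v) \<in> parcs D \<Longrightarrow> (v, w) \<in> parcs D \<Longrightarrow> distinct [u, v, w] \<Longrightarrow>
   apath u [(u, v), (v, w)] w"
  by (auto simp: apath_def awalk_def dest: arc_verts)

lemma apath_three_arcs:
  "(u, v) \<in> parcs D \<Longrightarrow> (v, w) \<in> parcs D \<Longrightarrow> (w, x) \<in> parcs D \<Longrightarrow> distinct [u, v, w, x] \<Longrightarrow>
   apath u [(u, v), (v, w), (w, x)] x"
  by (auto simp: apath_def awalk_def dest: arc_verts)

text \<open>A leaf has \<open>r\<close> as its only neighbour, so the first arc of the path must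
  enter \<open>r\<close> and, by symmetry of the arcs, the last one must leave it.\<close>

lemma apath_between_leaves:
  assumes "u \<in> leaves_at D r" "v \<in> leaves_at D r" "u \<noteq> v" "apath u p v"
  shows "(u, r) \<in> set p \<and> (r, v) \<in> set p"
proof -
  have aw: "awalk u p v" using assms(4) by (simp add: apath_def)
  with \<open>u \<noteq> v\<close> have ne: "p \<noteq> []" by (auto simp: awalk_def)
  have "set p \<subseteq> parcs D" using aw by (auto simp: awalk_def)
  then have hd_arc: "hd p \<in> parcs D" and last_arc: "last p \<in> parcs D" using ne by auto
  have "fst (hd p) = u"
    using aw ne by (cases p) (auto simp: awalk_Cons_iff)
  moreover have "snd (last p) = v"
    using aw ne by (cases p rule: rev_cases) (auto simp: awalk_simps)
  ultimately obtain x y where xy: "hd p = (u, x)" "last p = (y, v)"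
    by (metis prod.collapse)
  then have "(u, x) \<in> parcs D" "(v, y) \<in> parcs D"
    using hd_arc last_arc arc_sym by simp_all
  then have "x = r" "y = r"
    using assms(1,2) by (simp_all add: leaves_at_def)
  with xy have "hd p = (u, r)" "last p = (r, v)" by simp_all
  then show ?thesis using ne by (metis hd_in_set last_in_set)
qed

text \<open>A rainbow path between two leaves uses both their edges to \<open>r\<close>, so these
  edges carry distinct colours out of the \<open>k\<close> available ones.\<close>

lemma card_leaves_le:
  assumes "edge_coloring D k c" "rainbow_connected D c"
  shows "card (leaves_at D r) \<le> k"
proof -
  have arc: "(r, v) \<in> parcs D" if "v \<in> leaves_at D r" for v
    using that dominating by (auto simp: leaves_at_def)
  have "inj_on (\<lambda>v. c (r, v)) (leaves_at D r)"
  proof (intro inj_onI, rule ccontr)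
    fix u v
    assume uv: "u \<in> leaves_at D r" "v \<in> leaves_at D r" "c (r, u) = c (r, v)" "u \<noteq> v"
    have "u \<in> pverts D" "v \<in> pverts D" using uv by (auto simp: leaves_at_def)
    with assms(2) uv(4) obtain p where p: "apath u p v" "distinct (map c p)"
      unfolding rainbow_connected_def by blast
    have "(u, r) \<in> set p" "(r, v) \<in> set p"
      using apath_between_leaves uv p by blast+
    moreover have "c (u, r) = c (r, v)"
      using assms(1) arc[OF uv(1)] uv(3) by (auto simp: edge_coloring_def)
    \<comment> \<open>Arcs of equal colour on a rainbow path coincide; here that would mean
      \<open>u = r = v\<close>.\<close>
    ultimately have "(u, r) = (r, v)"
      using p(2) by (auto simp: distinct_map dest: inj_onD)
    then show False using uv by simp
  qed
  moreover have "(\<lambda>v. c (r, v)) ` leaves_at D r \<subseteq> {..<k}"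
    using assms(1) arc by (auto simp: edge_coloring_def)
  ultimately show ?thesis
    by (metis card_inj_on_le card_lessThan finite_lessThan)
qed

text \<open>Independence of \<open>A\<close> puts the relevant neighbours of a member outside
  \<open>A\<close>; maximality gives every nonmember a neighbour inside.\<close>

lemma opposite_neighbours:
  obtains A where
    "\<And>v. v \<in> pverts D \<Longrightarrow> v \<noteq> r \<Longrightarrow> v \<notin> leaves_at D r \<Longrightarrow>
      \<exists>w. (v, w) \<in> parcs D \<and> w \<noteq> r \<and> w \<notin> leaves_at D r \<and> (w \<in> A \<longleftrightarrow> v \<notin> A)"
proof -
  define N where "N = {v \<in> pverts D. v \<noteq> r \<and> v \<notin> leaves_at D r}"
  define \<I> where "\<I> = {A. A \<subseteq> N \<and> (\<forall>a \<in> A. \<forall>b \<in> A. (a, b) \<notin> parcs D)}"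
  have "finite N" using finite_verts by (auto simp: N_def)
  then have "finite \<I>" by (auto simp: \<I>_def intro: finite_subset[of _ "Pow N"])
  moreover have "{} \<in> \<I>" by (simp add: \<I>_def)
  ultimately obtain A where A: "A \<in> \<I>" and max: "\<And>B. B \<in> \<I> \<Longrightarrow> A \<subseteq> B \<Longrightarrow> A = B"
    using finite_has_maximal[of \<I>] by blast
  have "\<exists>w. (v, w) \<in> parcs D \<and> w \<noteq> r \<and> w \<notin> leaves_at D r \<and> (w \<in> A \<longleftrightarrow> v \<notin> A)"
    if v: "v \<in> pverts D" "v \<noteq> r" "v \<notin> leaves_at D r" for v
  proof (cases "v \<in> A")
    case True
    obtain w where w: "(v, w) \<in> parcs D" "w \<noteq> r"
      using v by (auto simp: leaves_at_def)
    \<comment> \<open>The vertex \<open>v\<close> is a neighbour of \<open>w\<close> other than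
      \<open>r\<close>.\<close>
    then have "w \<notin> leaves_at D r"
      using arc_sym v(2) by (auto simp: leaves_at_def)
    with w True A show ?thesis by (auto simp: \<I>_def)
  next
    case False
    \<comment> \<open>As there is no loop at \<open>v\<close>, adding \<open>v\<close> can destroy
      independence only through an arc between \<open>v\<close> and \<open>A\<close>.\<close>
    then have "insert v A \<notin> \<I>" using max by blast
    moreover have "insert v A \<subseteq> N" using v A by (auto simp: N_def \<I>_def)
    moreover have "(v, v) \<notin> parcs D" using no_loops by fastforce
    ultimately obtain w where "w \<in> A" "(v, w) \<in> parcs D"
      using A arc_sym unfolding \<I>_def by blast
    with A False show ?thesis by (auto simp: \<I>_def N_def)
  qed
  then show thesis by (rule that)
qed

lemma ex_rainbow_coloring:
  "\<exists>c. edge_coloring D (max 3 (card (leaves_at D r))) c \<and> rainbow_connected D c"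
proof -
  let ?L = "leaves_at D r"
  obtain A where A: "\<And>v. v \<in> pverts D \<Longrightarrow> v \<noteq> r \<Longrightarrow> v \<notin> ?L \<Longrightarrow>
      \<exists>w. (v, w) \<in> parcs D \<and> w \<noteq> r \<and> w \<notin> ?L \<and> (w \<in> A \<longleftrightarrow> v \<notin> A)"
    using opposite_neighbours by blast
  obtain f where f: "bij_betw f ?L {0..<card ?L}"
    using ex_bij_betw_finite_nat[OF finite_leaves] by blast
  \<comment> \<open>The leaf colours start at 0 and may overlap with 0, 1 and 2, which keeps the
    total at \<open>max 3 (card ?L)\<close>. Clashes between a leaf and a nonleaf are resolved by
    \<open>detour\<close>.\<close>
  define g where "g v = (if v \<in> ?L then f v else if v \<in> A then 0 else 1)" for v :: 'a
  define c where "c = (\<lambda>(u, v). if u = r then g v else if v = r then g u else (2::nat))"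
  have "g v < max 3 (card ?L)" for v
    using f by (auto simp: g_def bij_betw_def less_max_iff_disj)
  then have col: "edge_coloring D (max 3 (card ?L)) c"
    by (auto simp: edge_coloring_def c_def less_max_iff_disj)
  have root_arc: "(v, r) \<in> parcs D \<and> (r, v) \<in> parcs D" if "v \<in> pverts D" "v \<noteq> r" for v
    using that dominating arc_sym by blast
  \<comment> \<open>From a nonleaf \<open>v\<close> the root is reached through \<open>w\<close>
    with colours 2 and \<open>g w\<close>, which leaves the colour \<open>g v\<close> free for a
    third edge.\<close>
  have detour: "\<exists>w. (v, w) \<in> parcs D \<and> (w, v) \<in> parcs D \<and> (w, r) \<in> parcs D \<and> (r, w) \<in> parcs D
      \<and> w \<noteq> r \<and> w \<noteq> v \<and> g w \<noteq> g v \<and> g w \<noteq> 2 \<and> g v \<noteq> 2"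
    if v: "v \<in> pverts D" "v \<noteq> r" "v \<notin> ?L" for v
  proof -
    obtain w where w: "(v, w) \<in> parcs D" "w \<noteq> r" "w \<notin> ?L" "w \<in> A \<longleftrightarrow> v \<notin> A"
      using A[OF v] by blast
    then have "w \<in> pverts D" using arc_verts by blast
    with w v show ?thesis
      using arc_sym root_arc by (intro exI[of _ w]) (auto simp: g_def)
  qed
  have "\<exists>p. apath u p v \<and> distinct (map c p)"
    if uv: "u \<in> pverts D" "v \<in> pverts D" "u \<noteq> v" for u v
  proof -
    \<comment> \<open>Two vertices with equal labels cannot both be leaves, so a detour is available
      at one of them.\<close>
    have "g u \<noteq> g v" if "u \<in> ?L" "v \<in> ?L"
      using that f uv(3) by (auto simp: g_def bij_betw_def dest: inj_onD)
    then consider "u = r \<or> v = r" | "u \<noteq> r" "v \<noteq> r" "g u \<noteq> g v"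
      | "u \<noteq> r" "v \<noteq> r" "g u = g v" "v \<notin> ?L" | "u \<noteq> r" "v \<noteq> r" "g u = g v" "u \<notin> ?L"
      by blast
    then show ?thesis
    proof cases
      case 1
      then show ?thesis
        using apath_arc[of u v] root_arc uv by (intro exI[of _ "[(u, v)]"]) auto
    next
      case 2
      then show ?thesis
        using apath_two_arcs[of u r v] root_arc uv
        by (intro exI[of _ "[(u, r), (r, v)]"]) (auto simp: c_def)
    next
      case 3
      then obtain w where "(w, v) \<in> parcs D" "(r, w) \<in> parcs D"
        "w \<noteq> r" "w \<noteq> v" "g w \<noteq> g v" "g w \<noteq> 2" "g v \<noteq> 2"
        using detour uv by blast
      \<comment> \<open>The colours along the path are \<open>g u = g v\<close>, \<open>g w\<close>
        and 2; the labels also show that \<open>w\<close> differs from \<open>u\<close>.\<close>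
      then show ?thesis
        using apath_three_arcs[of u r w v] root_arc uv 3
        by (intro exI[of _ "[(u, r), (r, w), (w, v)]"]) (auto simp: c_def)
    next
      case 4
      then obtain w where "(u, w) \<in> parcs D" "(w, r) \<in> parcs D"
        "w \<noteq> r" "w \<noteq> u" "g w \<noteq> g u" "g w \<noteq> 2" "g u \<noteq> 2"
        using detour uv by blast
      then show ?thesis
        using apath_three_arcs[of u w r v] root_arc uv 4
        by (intro exI[of _ "[(u, w), (w, r), (r, v)]"]) (auto simp: c_def)
    qed
  qed
  then have "rainbow_connected D c" by (auto simp: rainbow_connected_def)
  with col show ?thesis by blast
qed

text \<open>The constructed colouring ensures that the \<open>LEAST\<close> is attained, so the
  lower bound applies to its value.\<close>

lemma rainbow_connection_number_bounds:
  "card (leaves_at D r) \<le> rainbow_connection_number D"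
  "rainbow_connection_number D \<le> max 3 (card (leaves_at D r))"
proof -
  let ?P = "\<lambda>k. \<exists>c. edge_coloring D k c \<and> rainbow_connected D c"
  have "?P (rainbow_connection_number D)"
    unfolding rainbow_connection_number_def
    by (rule LeastI[of ?P, OF ex_rainbow_coloring])
  then show "card (leaves_at D r) \<le> rainbow_connection_number D"
    using card_leaves_le by blast
  show "rainbow_connection_number D \<le> max 3 (card (leaves_at D r))"
    unfolding rainbow_connection_number_def
    by (rule Least_le[of ?P, OF ex_rainbow_coloring])
qed

end

section \<open>Leaves of the commuting graph and maximal abelian subgroups\<close>

context group
begin

lemma dominated_graph_commuting_graph:
  assumes "finite (carrier G)"
  shows "dominated_graph (commuting_graph G) \<one>"
proof -
  interpret pair_graph "commuting_graph G"
    using assms by (rule pair_graph_commuting_graph)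
  show ?thesis
    by unfold_locales (auto simp: commuting_graph_def)
qed

text \<open>In group terms, \<open>x\<close> is a nonidentity element with centralizer
  \<open>{\<one>, x}\<close>, hence an involution.\<close>

lemma commuting_leaves_iff:
  "x \<in> leaves_at (commuting_graph G) \<one> \<longleftrightarrow>
    x \<in> carrier G \<and> x \<noteq> \<one> \<and> (\<forall>y \<in> carrier G. x \<otimes> y = y \<otimes> x \<longrightarrow> y = \<one> \<or> y = x)"
  by (auto simp: leaves_at_def commuting_graph_def)

text \<open>The witness is the bicommutant of \<open>{x, y}\<close>.\<close>

lemma abelian_subgroup_of_commuting_pair:
  assumes xy: "x \<in> carrier G" "y \<in> carrier G" "x \<otimes> y = y \<otimes> x"
  obtains K where "abelian_subgroup K G" "x \<in> K" "y \<in> K"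
proof -
  define C where "C = {c \<in> carrier G. c \<otimes> x = x \<otimes> c \<and> c \<otimes> y = y \<otimes> c}"
  define K where "K = {g \<in> carrier G. \<forall>c \<in> C. g \<otimes> c = c \<otimes> g}"
  have in_K: "x \<in> K" "y \<in> K" using xy by (auto simp: K_def C_def)
  have "x \<in> C" "y \<in> C" using xy by (auto simp: C_def)
  \<comment> \<open>Elements of \<open>K\<close> commute with all of \<open>C\<close>, in particular
    with \<open>x\<close> and \<open>y\<close>. Once \<open>K\<close> lies in \<open>C\<close>, its
    elements commute with each other.\<close>
  then have "K \<subseteq> C" by (auto simp: K_def C_def)
  have sub: "subgroup K G"
  proof (rule subgroupI)
    show "K \<subseteq> carrier G" by (auto simp: K_def)
    show "K \<noteq> {}" using in_K by blast
  next
    fix a assume a: "a \<in> K"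
    have "inv a \<otimes> c = c \<otimes> inv a" if "c \<in> C" for c
    proof -
      have carr: "a \<in> carrier G" "c \<in> carrier G" and comm: "a \<otimes> c = c \<otimes> a"
        using a that by (auto simp: K_def C_def)
      have "a \<otimes> (c \<otimes> inv a) = c \<otimes> a \<otimes> inv a"
        using carr by (simp flip: m_assoc comm)
      also have "\<dots> = c" using carr by (simp add: m_assoc)
      finally show ?thesis using carr by (simp add: inv_solve_left')
    qed
    with a show "inv a \<in> K" by (auto simp: K_def)
  next
    fix a b assume ab: "a \<in> K" "b \<in> K"
    have "a \<otimes> b \<otimes> c = c \<otimes> (a \<otimes> b)" if "c \<in> C" for c
    proof -
      have carr: "a \<in> carrier G" "b \<in> carrier G" "c \<in> carrier G"
        and comm: "a \<otimes> c = c \<otimes> a" "b \<otimes> c = c \<otimes> b"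
        using ab that by (auto simp: K_def C_def)
      have "a \<otimes> b \<otimes> c = a \<otimes> c \<otimes> b" using carr by (simp add: comm(2) m_assoc)
      also have "\<dots> = c \<otimes> (a \<otimes> b)" using carr by (simp add: comm(1) flip: m_assoc)
      finally show ?thesis .
    qed
    with ab show "a \<otimes> b \<in> K" by (auto simp: K_def)
  qed
  interpret K: group "G\<lparr>carrier := K\<rparr>"
    using subgroup_imp_group[OF sub] .
  have "comm_group (G\<lparr>carrier := K\<rparr>)"
    by (rule K.group_comm_groupI) (use \<open>K \<subseteq> C\<close> in \<open>auto simp: K_def\<close>)
  with sub in_K show thesis by (intro that) (auto simp: abelian_subgroup_def)
qed

lemma abelian_subgroup_commute:
  assumes "abelian_subgroup K G" "x \<in> K" "y \<in> K"
  shows "x \<otimes> y = y \<otimes> x"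
proof -
  interpret K: comm_group "G\<lparr>carrier := K\<rparr>"
    using assms(1) by (simp add: abelian_subgroup_def)
  show ?thesis using K.m_comm[of x y] assms by simp
qed

text \<open>Every abelian subgroup through \<open>x\<close> lies in the centralizer
  \<open>{\<one>, x}\<close>. Since one exists, it equals \<open>{\<one>, x}\<close>; since this
  bounds all of them, it is maximal.\<close>

lemma maximal_abelian_of_leaf:
  assumes "x \<in> leaves_at (commuting_graph G) \<one>"
  shows "maximal_abelian_subgroup {\<one>, x} G"
proof -
  have x: "x \<in> carrier G"
    and leaf: "\<And>y. y \<in> carrier G \<Longrightarrow> x \<otimes> y = y \<otimes> x \<Longrightarrow> y = \<one> \<or> y = x"
    using assms by (auto simp: commuting_leaves_iff)
  obtain K where K: "abelian_subgroup K G" "x \<in> K"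
    using abelian_subgroup_of_commuting_pair[of x x] x by blast
  have le: "K' \<subseteq> {\<one>, x}" if "abelian_subgroup K' G" "x \<in> K'" for K'
  proof
    fix y assume "y \<in> K'"
    moreover from this have "y \<in> carrier G"
      using that(1) unfolding abelian_subgroup_def by (blast dest: subgroup.mem_carrier)
    ultimately show "y \<in> {\<one>, x}"
      using leaf abelian_subgroup_commute[OF that] by blast
  qed
  have "\<one> \<in> K" using K by (auto simp: abelian_subgroup_def subgroup.one_closed)
  with K le have "K = {\<one>, x}" by blast
  with K le show ?thesis by (auto simp: maximal_abelian_subgroup_def)
qed

text \<open>If \<open>y\<close> commutes with \<open>x\<close>, some abelian subgroup contains both,
  and maximality confines it to \<open>{\<one>, x}\<close>.\<close>

lemma leaf_of_maximal_abelian: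
  assumes "maximal_abelian_subgroup {\<one>, x} G" "x \<noteq> \<one>"
  shows "x \<in> leaves_at (commuting_graph G) \<one>"
proof -
  have "abelian_subgroup {\<one>, x} G"
    and max: "\<And>K. abelian_subgroup K G \<Longrightarrow> \<not> {\<one>, x} \<subset> K"
    using assms by (auto simp: maximal_abelian_subgroup_def)
  then have x: "x \<in> carrier G"
    by (auto simp: abelian_subgroup_def dest: subgroup.mem_carrier)
  have "y = \<one> \<or> y = x" if y: "y \<in> carrier G" "x \<otimes> y = y \<otimes> x" for y
  proof -
    obtain K where "abelian_subgroup K G" "x \<in> K" "y \<in> K"
      using abelian_subgroup_of_commuting_pair x y by blast
    moreover from this have "\<one> \<in> K"
      by (auto simp: abelian_subgroup_def subgroup.one_closed)
    ultimately show ?thesis using max by blast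
  qed
  with x assms(2) show ?thesis by (simp add: commuting_leaves_iff)
qed

text \<open>The map from \<open>x\<close> to \<open>{\<one>, x}\<close> is a bijection; injectivity
  rests on leaves differing from \<open>\<one>\<close>.\<close>

lemma card_maximal_abelian_order_2:
  "card {H. maximal_abelian_subgroup H G \<and> order (G\<lparr>carrier := H\<rparr>) = 2} =
   card (leaves_at (commuting_graph G) \<one>)" (is "card ?M = card ?L")
proof -
  have "?M = (\<lambda>x. {\<one>, x}) ` ?L"
  proof (intro equalityI subsetI)
    fix H assume H: "H \<in> ?M"
    then have "\<one> \<in> H" "card H = 2"
      by (auto simp: maximal_abelian_subgroup_def abelian_subgroup_def order_def
          subgroup.one_closed)
    then obtain x where "H = {\<one>, x}" "x \<noteq> \<one>"
      by (auto simp: card_2_iff)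
    with H leaf_of_maximal_abelian show "H \<in> (\<lambda>x. {\<one>, x}) ` ?L" by auto
  qed (auto simp: maximal_abelian_of_leaf order_def commuting_leaves_iff)
  moreover have "inj_on (\<lambda>x. {\<one>, x}) ?L"
    by (auto simp: inj_on_def commuting_leaves_iff doubleton_eq_iff)
  ultimately show ?thesis by (simp add: card_image)
qed

text \<open>A central element lies in the centralizers of both leaves, which meet only in
  \<open>\<one>\<close>.\<close>

lemma trivial_center_of_two_leaves:
  assumes "x \<in> leaves_at (commuting_graph G) \<one>" "y \<in> leaves_at (commuting_graph G) \<one>" "x \<noteq> y"
  shows "group_center G = {\<one>}"
proof -
  have "z = \<one>" if "z \<in> group_center G" for z
  proof -
    have "z \<in> carrier G" "x \<otimes> z = z \<otimes> x" "y \<otimes> z = z \<otimes> y"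
      using that assms by (auto simp: group_center_def commuting_leaves_iff)
    then have "z = \<one> \<or> z = x" "z = \<one> \<or> z = y"
      using assms unfolding commuting_leaves_iff by blast+
    with assms(3) show ?thesis by blast
  qed
  then show ?thesis by (auto simp: group_center_def)
qed

text \<open>Distinct commuting leaves would be adjacent, but a leaf has only the identity as
  neighbour.\<close>

lemma nonabelian_of_two_leaves:
  assumes "x \<in> leaves_at (commuting_graph G) \<one>" "y \<in> leaves_at (commuting_graph G) \<one>" "x \<noteq> y"
  shows "\<not> comm_group G"
proof
  assume "comm_group G"
  then interpret comm_group G .
  have "x \<otimes> y = y \<otimes> x"
    using assms by (simp add: m_comm commuting_leaves_iff)
  then show False using assms by (auto simp: commuting_leaves_iff)
qed

end

theorem theorem7:
  fixes \<Gamma> :: "('a, 'b) monoid_scheme" and t :: nat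
  assumes "t \<ge> 4"
    and "group \<Gamma>" and "finite (carrier \<Gamma>)"
  shows "rainbow_connection_number (commuting_graph \<Gamma>) = t \<longleftrightarrow>
           \<not> comm_group \<Gamma> \<and>
           group_center \<Gamma> = {\<one>\<^bsub>\<Gamma>\<^esub>} \<and>
           card {H. maximal_abelian_subgroup H \<Gamma> \<and> order (\<Gamma>\<lparr>carrier := H\<rparr>) = 2} = t"
proof -
  interpret group \<Gamma> by fact
  interpret dominated_graph "commuting_graph \<Gamma>" "\<one>\<^bsub>\<Gamma>\<^esub>"
    using assms(3) by (rule dominated_graph_commuting_graph)
  let ?L = "leaves_at (commuting_graph \<Gamma>) \<one>\<^bsub>\<Gamma>\<^esub>"
  \<comment> \<open>If the rainbow connection number is at least 4, then so is
    \<open>card ?L\<close>, and there the lower and upper bounds coincide.\<close>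
  have rc: "rainbow_connection_number (commuting_graph \<Gamma>) = t \<longleftrightarrow> card ?L = t"
    using rainbow_connection_number_bounds assms(1) by linarith
  \<comment> \<open>Since \<open>t\<close> is at least 4, the count provides two different leaves,
    and these force both properties.\<close>
  have "\<not> comm_group \<Gamma> \<and> group_center \<Gamma> = {\<one>\<^bsub>\<Gamma>\<^esub>}" if "card ?L = t"
  proof -
    have "\<not> card ?L \<le> Suc 0" using that assms(1) by simp
    then obtain x y where "x \<in> ?L" "y \<in> ?L" "x \<noteq> y"
      using card_le_Suc0_iff_eq[OF finite_leaves] by blast
    then show ?thesis
      using trivial_center_of_two_leaves nonabelian_of_two_leaves by blast
  qed
  with rc show ?thesis by (auto simp: card_maximal_abelian_order_2)
qed

end
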